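(* Let $\lambda>0$ and let $w:[0,1]\to\mathbb{R}$ be a continuous function for which there exist $x_0\in(0,1)$ and $c>0$ such that $|w(x)|\leq c(1-x)$ for all $x\in[1-x_0,1]$. Set $h_w(x):=\frac{w(x)}{1-x}$ for $x\in[0,1)$, and let $\Lambda_w:\mathbb{R}\to\mathbb{R}\cup\{\infty\}$ be defined by $$\Lambda_w(\theta):=\begin{cases}\displaystyle\int_0^1\log\left(\frac{\lambda}{\lambda-\theta h_w(x)}\right)dx & \text{if } \sup_{x\in[0,1)}\{\theta h_w(x)\}\leq\lambda,\\ \infty & \text{otherwise,}\end{cases}$$ and assume that $\Lambda_w$ is finite in a neighbourhood of $\theta=0$. Let $\Lambda_w^*(y):=\sup_{\theta\in\mathbb{R}}\{\theta y-\Lambda_w(\theta)\}$ for $y\in\mathbb{R}$. Assume moreover that $h_w(x)>0$ almost everywhere with respect to $x$ and, writing $h_w^{-1}(x):=1/h_w(x)$, set, for $y\in(0,\infty)$, $$M_w(y):=\int_0^1H\left(\mathcal{EXP}(1/y)\,|\,\mathcal{EXP}(\lambda h_w^{-1}(x))\right)dx.$$ Then: (i) $\Lambda_w^*(y)\leq M_w(y)$ for all $y\in(0,\infty)$; (ii) $\Lambda_w^*(y)=\infty$ for all $y\in(-\infty,0]$; (iii) the infimum of $M_w(y)$ is attained at $y=\bar{y}_w$, where $\bar{y}_w:=\left(\lambda\int_0^1h_w^{-1}(x)\,dx\right)^{-1}$.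
   Context: $\mathcal{EXP}(\eta)$ denotes the exponential distribution with rate $\eta>0$ (distribution function $1-e^{-\eta t}$, $t\geq0$). For two absolutely continuous real random variables $X_1,X_2$ with densities $f_1,f_2$, the relative entropy of (the law of) $X_1$ with respect to (the law of) $X_2$ is $H(X_1|X_2):=\int_{\mathbb{R}}f_1(x)\log\frac{f_1(x)}{f_2(x)}dx$; in particular, for $\lambda_1,\lambda_2>0$, $$H(\mathcal{EXP}(\lambda_1)|\mathcal{EXP}(\lambda_2))=\frac{\lambda_2}{\lambda_1}-1-\log\frac{\lambda_2}{\lambda_1}.$$ Here $h_w^{-1}(x)$ is the reciprocal $1/h_w(x)$, not the inverse function.
   Formalization: Part (iii) is asserted when the integral of 1/h_w is finite; if it is infinite (e.g. w(x)=(1-x)|x-1/2|), ȳ_w=0 lies outside the domain (0,∞) of M_w, and it is stated instead that ȳ_w=0 and M_w is identically infinite on (0,∞). *)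

theory Defs
  imports "HOL-Probability.Probability"
begin

text \<open>
  Integral over \<open>[0,1)\<close> of an extended-real-valued function, as the difference of the integrals of
  its positive and negative parts (\<open>e2ennreal\<close> sends negative arguments to \<open>0\<close>).  Only functions
  for which one of the two parts has finite integral are of interest; recall \<open>\<infinity> - \<infinity> = \<infinity>\<close> in
  \<open>ereal\<close>.  The endpoint \<open>1\<close> is left out since the integrands below contain the factor
  \<open>1 / (1 - x)\<close>.
\<close>

definition unit_integral :: "(real \<Rightarrow> ereal) \<Rightarrow> ereal" where
  "unit_integral f =
     enn2ereal (\<integral>\<^sup>+ x\<in>{0..<1}. e2ennreal (f x) \<partial>lborel) -
     enn2ereal (\<integral>\<^sup>+ x\<in>{0..<1}. e2ennreal (- f x) \<partial>lborel)"

definition ereal_log :: "ereal \<Rightarrow> ereal" where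
  "ereal_log x = (if x \<le> 0 then - \<infinity> else if x = \<infinity> then \<infinity> else ereal (ln (real_of_ereal x)))"

definition h_fun :: "(real \<Rightarrow> real) \<Rightarrow> real \<Rightarrow> real" where
  "h_fun w x = w x / (1 - x)"

text \<open>
  The quotient is taken in \<open>ereal\<close>, so that the integrand is \<open>log (lam / 0) = \<infinity>\<close> wherever
  \<open>\<theta> h_fun w x = lam\<close>.
\<close>

definition Lambda :: "real \<Rightarrow> (real \<Rightarrow> real) \<Rightarrow> real \<Rightarrow> ereal" where
  "Lambda lam w \<theta> =
     (if (SUP x\<in>{0..<1}. ereal (\<theta> * h_fun w x)) \<le> ereal lam
      then unit_integral (\<lambda>x. ereal_log (ereal lam / ereal (lam - \<theta> * h_fun w x)))
      else \<infinity>)"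

definition Lambda_star :: "real \<Rightarrow> (real \<Rightarrow> real) \<Rightarrow> real \<Rightarrow> ereal" where
  "Lambda_star lam w y = (SUP \<theta>. ereal (\<theta> * y) - Lambda lam w \<theta>)"

definition EXP :: "real \<Rightarrow> real measure" where
  "EXP \<eta> = density lborel (exponential_density \<eta>)"

text \<open>
  \<open>KL_divergence b M N\<close> is the divergence of \<open>N\<close> with respect to \<open>M\<close>, hence the swapped arguments.
\<close>

definition rel_entropy :: "real measure \<Rightarrow> real measure \<Rightarrow> real" where
  "rel_entropy P Q = KL_divergence (exp 1) Q P"

lemma rel_entropy_density:
  fixes f1 f2 :: "real \<Rightarrow> real"
  assumes "f1 \<in> borel_measurable lborel" "AE x in lborel. 0 \<le> f1 x"
    and "f2 \<in> borel_measurable lborel" "AE x in lborel. 0 \<le> f2 x"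
    and "AE x in lborel. f2 x = 0 \<longrightarrow> f1 x = 0"
  shows "rel_entropy (density lborel f1) (density lborel f2) =
    (\<integral>x. f1 x * ln (f1 x / f2 x) \<partial>lborel)"
proof -
  have "rel_entropy (density lborel f1) (density lborel f2) =
      (\<integral>x. f1 x * log (exp 1) (f1 x / f2 x) \<partial>lborel)"
    unfolding rel_entropy_def
    by (rule lborel.KL_density_density) (use assms in auto)
  then show ?thesis
    by (simp add: log_def)
qed

lemma rel_entropy_EXP:
  assumes "0 < l1" "0 < l2"
  shows "rel_entropy (EXP l1) (EXP l2) = l2 / l1 - 1 - ln (l2 / l1)"
proof -
  have "has_bochner_integral lborel (\<lambda>x. exponential_density l1 x * x ^ i) (fact i / l1 ^ i)" for i
    using nn_integral_erlang_ith_moment[OF assms(1), of 0 i] assms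
    by (intro has_bochner_integral_nn_integral) (auto simp: exponential_density_def)
  from this[of 0] this[of 1] have *: "integrable lborel (exponential_density l1)"
    "integral\<^sup>L lborel (exponential_density l1) = 1"
    "integrable lborel (\<lambda>x. exponential_density l1 x * x)"
    "integral\<^sup>L lborel (\<lambda>x. exponential_density l1 x * x) = 1 / l1"
    by (auto simp: has_bochner_integral_iff)
  have "rel_entropy (EXP l1) (EXP l2) =
      (\<integral>x. exponential_density l1 x * ln (exponential_density l1 x / exponential_density l2 x) \<partial>lborel)"
    unfolding EXP_def using assms
    by (intro rel_entropy_density) (auto simp: exponential_density_def)
  also have "\<dots> = (\<integral>x. (- ln (l2 / l1)) * exponential_density l1 x
      + (l2 - l1) * (exponential_density l1 x * x) \<partial>lborel)"
    using assms
    by (intro Bochner_Integration.integral_cong)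
       (auto simp: exponential_density_def ln_mult ln_div field_simps)
  also have "\<dots> = l2 / l1 - 1 - ln (l2 / l1)"
    using * assms by (simp add: diff_divide_distrib del: mult_minus_left)
  finally show ?thesis .
qed

definition M_fun :: "real \<Rightarrow> (real \<Rightarrow> real) \<Rightarrow> real \<Rightarrow> ereal" where
  "M_fun lam w y = unit_integral (\<lambda>x. ereal (rel_entropy (EXP (1 / y)) (EXP (lam * (1 / h_fun w x)))))"

definition h_inv_integral :: "(real \<Rightarrow> real) \<Rightarrow> ereal" where
  "h_inv_integral w = unit_integral (\<lambda>x. ereal (1 / h_fun w x))"

text \<open>Extended-real inverse: the value is \<open>0\<close> if the integral of \<open>1 / h_fun w\<close> diverges.\<close>

definition y_bar :: "real \<Rightarrow> (real \<Rightarrow> real) \<Rightarrow> ereal" where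
  "y_bar lam w = inverse (ereal lam * h_inv_integral w)"

end

theory Submission
  imports Defs
begin

text \<open>
  Write \<open>h\<close> for \<open>h_fun w\<close>. For \<open>u = lam - \<theta> * h x > 0\<close>, the inequality
  \<open>ln s \<le> s - 1\<close> at \<open>s = y * u / h x\<close> reads
  \<open>\<theta> * y - ln (lam / u) \<le> t - 1 - ln t\<close> with \<open>t = y * lam / h x\<close>; integrating it
  over \<open>x\<close> gives (i).  For \<open>y \<le> 0\<close> one lets \<open>\<theta>\<close> tend to \<open>- \<infinity>\<close>.  If the integral \<open>I\<close> of
  \<open>1 / h\<close> is finite, then \<open>M_fun lam w y\<close> equals \<open>y * lam * I - ln y\<close> up to an additive constant,
  which is minimal at \<open>y = 1 / (lam * I)\<close>; otherwise the bound \<open>t - 1 - ln t \<ge> t / 2 - ln 2\<close>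
  shows that \<open>M_fun\<close> is identically \<open>\<infinity>\<close>.
\<close>

section \<open>Integration over the unit interval\<close>

abbreviation unit_lborel :: "real measure" where
  "unit_lborel \<equiv> restrict_space lborel {0..<1}"

lemma prob_space_unit_lborel: "prob_space unit_lborel"
  by (rule prob_space_restrict_space) auto

lemma emeasure_unit_lborel [simp]: "emeasure unit_lborel {0..<1} = 1"
  using prob_space.emeasure_space_1[OF prob_space_unit_lborel] by (simp add: space_restrict_space)

lemma measure_unit_lborel [simp]: "measure unit_lborel {0..<1} = 1"
  by (simp add: measure_def)

lemma AE_unit_lborel_iff:
  "(AE x in unit_lborel. P x) \<longleftrightarrow> (AE x in lborel. x \<in> {0..<1} \<longrightarrow> P x)"
  by (rule AE_restrict_space_iff) auto

text \<open>Trading the indicator for a restricted measure makes the integrals live on a probability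
  space, where constants integrate to themselves and the usual rules for a.e. comparison
  apply.\<close>

lemma unit_integral_eq:
  "unit_integral f =
     enn2ereal (\<integral>\<^sup>+ x. e2ennreal (f x) \<partial>unit_lborel) -
     enn2ereal (\<integral>\<^sup>+ x. e2ennreal (- f x) \<partial>unit_lborel)"
  unfolding unit_integral_def by (simp add: nn_integral_restrict_space)

lemma unit_integral_cong_AE:
  assumes "AE x in unit_lborel. f x = g x"
  shows "unit_integral f = unit_integral g"
proof -
  have "(\<integral>\<^sup>+ x. e2ennreal (f x) \<partial>unit_lborel) = (\<integral>\<^sup>+ x. e2ennreal (g x) \<partial>unit_lborel)"
    "(\<integral>\<^sup>+ x. e2ennreal (- f x) \<partial>unit_lborel) = (\<integral>\<^sup>+ x. e2ennreal (- g x) \<partial>unit_lborel)"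
    using assms by (auto intro!: nn_integral_cong_AE)
  then show ?thesis by (simp add: unit_integral_eq)
qed

lemma unit_integral_nonneg:
  assumes "AE x in unit_lborel. 0 \<le> f x"
  shows "unit_integral f = enn2ereal (\<integral>\<^sup>+ x. e2ennreal (f x) \<partial>unit_lborel)"
proof -
  have "(\<integral>\<^sup>+ x. e2ennreal (- f x) \<partial>unit_lborel) = (\<integral>\<^sup>+ x. 0 \<partial>unit_lborel)"
    using assms by (intro nn_integral_cong_AE) (auto simp: e2ennreal_neg)
  then show ?thesis by (simp add: unit_integral_eq zero_ennreal.rep_eq)
qed

lemma unit_integral_nonpos:
  assumes "AE x in unit_lborel. f x \<le> 0"
  shows "unit_integral f = - enn2ereal (\<integral>\<^sup>+ x. e2ennreal (- f x) \<partial>unit_lborel)"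
proof -
  have "(\<integral>\<^sup>+ x. e2ennreal (f x) \<partial>unit_lborel) = (\<integral>\<^sup>+ x. 0 \<partial>unit_lborel)"
    using assms by (intro nn_integral_cong_AE) (auto simp: e2ennreal_neg)
  then show ?thesis by (simp add: unit_integral_eq zero_ennreal.rep_eq)
qed

lemma unit_integral_integrable:
  assumes "integrable unit_lborel f"
  shows "unit_integral (\<lambda>x. ereal (f x)) = ereal (\<integral>x. f x \<partial>unit_lborel)"
proof -
  have "(\<integral>\<^sup>+ x. ennreal (f x) \<partial>unit_lborel) \<noteq> \<infinity>" "(\<integral>\<^sup>+ x. ennreal (- f x) \<partial>unit_lborel) \<noteq> \<infinity>"
    using assms by (auto simp: real_integrable_def)
  then obtain p n where "(\<integral>\<^sup>+ x. ennreal (f x) \<partial>unit_lborel) = ennreal p" "0 \<le> p"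
     "(\<integral>\<^sup>+ x. ennreal (- f x) \<partial>unit_lborel) = ennreal n" "0 \<le> n"
    by (metis ennreal_cases infinity_ennreal_def)
  then show ?thesis
    using real_lebesgue_integral_def[OF assms]
    by (simp add: unit_integral_eq ennreal.rep_eq e2ennreal_ereal)
qed

text \<open>The integral of \<open>g\<close> may be infinite, so the pointwise bound cannot simply
  be integrated as a difference. All terms are first moved to the side where they are nonnegative,
  and the resulting inequality in \<open>ennreal\<close> is integrated.\<close>

lemma const_minus_unit_integral_le:
  fixes a :: real
  assumes [measurable]: "g \<in> borel_measurable unit_lborel" "m \<in> borel_measurable unit_lborel"
    and m: "AE x in unit_lborel. 0 \<le> m x"
    and le: "AE x in unit_lborel. ereal a - g x \<le> m x"
    and neg: "(\<integral>\<^sup>+ x. e2ennreal (- g x) \<partial>unit_lborel) < \<infinity>"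
  shows "ereal a - unit_integral g \<le> unit_integral m"
proof -
  define P where "P = (\<integral>\<^sup>+ x. e2ennreal (g x) \<partial>unit_lborel)"
  define N where "N = (\<integral>\<^sup>+ x. e2ennreal (- g x) \<partial>unit_lborel)"
  define K where "K = (\<integral>\<^sup>+ x. e2ennreal (m x) \<partial>unit_lborel)"
  \<comment> \<open>Since \<open>ennreal\<close> truncates at 0, \<open>ennreal a\<close> and
    \<open>ennreal (- a)\<close> are the positive and negative parts of \<open>a\<close>; the same
    holds for \<open>g x\<close> under \<open>e2ennreal\<close>.\<close>
  have "AE x in unit_lborel. ennreal a + e2ennreal (- g x) \<le> e2ennreal (m x) + e2ennreal (g x) + ennreal (- a)"
    using m le
  proof eventually_elim
    case (elim x)
    show ?case
    proof (cases "g x")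
      case (real r)
      show ?thesis
      proof (cases "m x")
        case (real s)
        then have "0 \<le> s" "a - r \<le> s" using elim \<open>g x = ereal r\<close> by auto
        then show ?thesis using \<open>g x = ereal r\<close> real
          by (cases "0 \<le> a"; cases "0 \<le> r")
            (auto simp: e2ennreal_ereal ennreal_neg simp flip: ennreal_plus intro!: ennreal_leI)
      qed (use elim in auto)
    qed (use elim in \<open>auto simp: e2ennreal_neg\<close>)
  qed
  then have "(\<integral>\<^sup>+ x. ennreal a + e2ennreal (- g x) \<partial>unit_lborel)
      \<le> (\<integral>\<^sup>+ x. e2ennreal (m x) + e2ennreal (g x) + ennreal (- a) \<partial>unit_lborel)"
    by (rule nn_integral_mono_AE)
  then have *: "ennreal a + N \<le> K + P + ennreal (- a)"
    by (simp add: nn_integral_add P_def N_def K_def)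
  obtain n where n: "N = ennreal n" "0 \<le> n"
    using neg by (cases N) (auto simp: N_def)
  have "ereal a - (enn2ereal P - enn2ereal N) \<le> enn2ereal K"
  \<comment> \<open>An infinite \<open>P\<close> makes the left side minus infinity, as
    \<open>N\<close> is finite, and an infinite \<open>K\<close> makes the right side infinite.
    Otherwise \<open>*\<close> is an inequality between real numbers.\<close>
  proof (cases P)
    case (real p)
    note p = this
    show ?thesis
    proof (cases K)
      case (real k)
      have pos_part: "ennreal (max 0 b) = ennreal b" for b
        by (simp add: max_def ennreal_neg)
      have "ennreal (max 0 a + n) = ennreal a + N"
        using n by (simp only: ennreal_plus pos_part max.cobounded1)
      also note *
      also have "K + P + ennreal (- a) = ennreal (k + p + max 0 (-a))"
        using p real by (simp only: ennreal_plus pos_part max.cobounded1 add_nonneg_nonneg)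
      finally have "max 0 a + n \<le> k + p + max 0 (-a)"
        using p real by (subst (asm) ennreal_le_iff) (rule add_nonneg_nonneg, auto)
      then show ?thesis using n p real by (auto simp: ennreal.rep_eq)
    qed (simp add: top_ennreal.rep_eq)
  qed (use n in \<open>simp add: top_ennreal.rep_eq ennreal.rep_eq\<close>)
  then show ?thesis
    unfolding unit_integral_nonneg[OF m] unit_integral_eq[of g] P_def N_def K_def .
qed

section \<open>Logarithm and exponential relative entropy as functions of one variable\<close>

lemma ereal_log_measurable [measurable]: "ereal_log \<in> borel_measurable borel"
  unfolding ereal_log_def by measurable

text \<open>By \<open>rel_entropy_EXP\<close> this is the relative entropy of two exponential laws,
  where \<open>t\<close> is the rate of the second divided by the rate of the first.\<close>

definition exp_rel_entropy :: "real \<Rightarrow> real" where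
  "exp_rel_entropy t = t - 1 - ln t"

lemma exp_rel_entropy_nonneg: "0 < t \<Longrightarrow> 0 \<le> exp_rel_entropy t"
  using ln_le_minus_one[of t] by (simp add: exp_rel_entropy_def)

text \<open>The tangent to \<open>ln\<close> at 2 lies above \<open>ln\<close> and has slope 1/2, so
  half of the linear term survives. This is what lets a finite entropy integral control the integral
  of \<open>1 / h\<close>.\<close>

lemma exp_rel_entropy_ge: "0 < t \<Longrightarrow> t / 2 - ln 2 \<le> exp_rel_entropy t"
  using ln_le_minus_one[of "t / 2"] by (simp add: exp_rel_entropy_def ln_div)

section \<open>Boundedness, measurability and sign of \<open>h_fun\<close>\<close>

context
  fixes lam :: real and w :: "real \<Rightarrow> real"
  assumes lam: "0 < lam"
    and cont: "continuous_on {0..1} w"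
    and endpoint: "\<exists>x0 c. x0 \<in> {0<..<1} \<and> 0 < c \<and> (\<forall>x\<in>{1 - x0..1}. \<bar>w x\<bar> \<le> c * (1 - x))"
    and pos: "AE x in lborel. x \<in> {0..<1} \<longrightarrow> 0 < h_fun w x"
begin

lemma continuous_on_h_fun: "continuous_on {0..<1} (h_fun w)"
  unfolding h_fun_def
  by (intro continuous_intros continuous_on_subset[OF cont]) auto

lemma h_fun_measurable [measurable]: "h_fun w \<in> borel_measurable unit_lborel"
proof -
  have "h_fun w \<in> borel_measurable (restrict_space borel {0..<1})"
    by (rule borel_measurable_continuous_on_restrict[OF continuous_on_h_fun])
  then show ?thesis by (simp add: measurable_def space_restrict_space sets_restrict_space)
qed

lemma AE_h_fun_pos: "AE x in unit_lborel. 0 < h_fun w x"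
  using pos by (simp add: AE_unit_lborel_iff)

text \<open>Away from 1 the bound is compactness; near 1 the endpoint condition on \<open>w\<close>
  absorbs the factor \<open>1 / (1 - x)\<close>.\<close>

lemma h_fun_bounded:
  obtains B where "0 < B" "\<And>x. x \<in> {0..<1} \<Longrightarrow> \<bar>h_fun w x\<bar> \<le> B"
proof -
  obtain x0 c where *: "0 < x0" "x0 < 1" "0 < c" "\<And>x. x \<in> {1 - x0..1} \<Longrightarrow> \<bar>w x\<bar> \<le> c * (1 - x)"
    using endpoint by auto
  have "compact (h_fun w ` {0..1 - x0})"
    using * by (intro compact_continuous_image continuous_on_subset[OF continuous_on_h_fun]) auto
  then obtain b where b: "0 < b" "\<And>x. x \<in> {0..1 - x0} \<Longrightarrow> \<bar>h_fun w x\<bar> \<le> b"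
    by (auto dest!: compact_imp_bounded simp: bounded_pos)
  show ?thesis
  proof (rule that[of "max b c"])
    fix x :: real assume x: "x \<in> {0..<1}"
    show "\<bar>h_fun w x\<bar> \<le> max b c"
    proof (cases "x \<le> 1 - x0")
      case True
      then show ?thesis using b(2)[of x] x by auto
    next
      case False
      then have "\<bar>h_fun w x\<bar> \<le> c"
        using *(4)[of x] x by (simp add: h_fun_def abs_divide divide_le_eq)
      then show ?thesis by simp
    qed
  qed (use b in auto)
qed

text \<open>A negative value of the continuous function \<open>h_fun w\<close> would persist on an interval, which is
  not a null set.\<close>

lemma h_fun_nonneg:
  assumes x: "x \<in> {0..<1}"
  shows "0 \<le> h_fun w x"
proof (rule ccontr)
  assume "\<not> 0 \<le> h_fun w x"
  then obtain d where d: "0 < d" "\<And>z. z \<in> {0..<1} \<Longrightarrow> dist z x < d \<Longrightarrow> dist (h_fun w z) (h_fun w x) < - h_fun w x"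
    using continuous_on_h_fun x unfolding continuous_on_iff by (metis neg_0_less_iff_less not_le)
  \<comment> \<open>The interval extends to the right of \<open>x\<close> only, so it stays in
    \<open>{0..<1}\<close> even if \<open>x = 0\<close>; the minimum with 1 handles the other
    end.\<close>
  define e where "e = min 1 (x + d)"
  have e: "x < e" using d x by (auto simp: e_def)
  have neg: "\<not> 0 < h_fun w z" if "z \<in> {x<..<e}" for z
    using d(2)[of z] that x by (auto simp: e_def dist_real_def)
  have "AE z in lborel. z \<notin> {x<..<e}"
    using pos
  proof eventually_elim
    case (elim z)
    then show ?case using neg[of z] x by (auto simp: e_def)
  qed
  then have "emeasure lborel {x<..<e} = 0"
    by (subst (asm) AE_iff_measurable[of "{x<..<e}"]) auto
  then show False using e by simp
qed

section \<open>Comparison of \<open>Lambda_star\<close> with \<open>M_fun\<close> and with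
  infinity\<close>

text \<open>The ratio of the rates \<open>lam / h\<close> and \<open>1 / y\<close> is
  \<open>y * lam / h\<close>. The closed form requires positive rates, hence the a.e.
  argument.\<close>

lemma M_fun_eq:
  assumes "0 < y"
  shows "M_fun lam w y = unit_integral (\<lambda>x. ereal (exp_rel_entropy (y * lam / h_fun w x)))"
  unfolding M_fun_def
proof (rule unit_integral_cong_AE)
  show "AE x in unit_lborel. ereal (rel_entropy (EXP (1 / y)) (EXP (lam * (1 / h_fun w x)))) =
      ereal (exp_rel_entropy (y * lam / h_fun w x))"
    using AE_h_fun_pos
    by eventually_elim (use assms lam in \<open>simp add: rel_entropy_EXP exp_rel_entropy_def mult.commute\<close>)
qed

lemma AE_exp_rel_entropy_nonneg:
  assumes "0 < y"
  shows "AE x in unit_lborel. 0 \<le> exp_rel_entropy (y * lam / h_fun w x)"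
  using AE_h_fun_pos by eventually_elim (use assms lam in \<open>simp add: exp_rel_entropy_nonneg\<close>)

lemma Lambda_star_le_M_fun:
  assumes y: "0 < y"
  shows "Lambda_star lam w y \<le> M_fun lam w y"
  unfolding Lambda_star_def
proof (rule SUP_least)
  fix \<theta> :: real
  obtain B where B: "0 < B" "\<And>x. x \<in> {0..<1} \<Longrightarrow> \<bar>h_fun w x\<bar> \<le> B"
    using h_fun_bounded by blast
  show "ereal (\<theta> * y) - Lambda lam w \<theta> \<le> M_fun lam w y"
  proof (cases "(SUP x\<in>{0..<1}. ereal (\<theta> * h_fun w x)) \<le> ereal lam")
    case True
    define g where "g x = ereal_log (ereal lam / ereal (lam - \<theta> * h_fun w x))" for x
    have le: "\<theta> * h_fun w x \<le> lam" if "x \<in> {0..<1}" for x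
      using True that by (auto simp: SUP_le_iff)
    \<comment> \<open>On the boundary of the constraint the \<open>ereal\<close> quotient
      \<open>lam / 0\<close> is infinite, whereas the real quotient would be 0, so this case is kept
      apart. There the bound on \<open>\<theta> * y - g x\<close> is trivial.\<close>
    have g: "g x = (if \<theta> * h_fun w x = lam then \<infinity> else ereal (ln (lam / (lam - \<theta> * h_fun w x))))"
      if "x \<in> {0..<1}" for x
    proof (cases "\<theta> * h_fun w x = lam")
      case True
      then show ?thesis using lam by (simp add: g_def ereal_log_def divide_ereal_def)
    next
      case False
      then have "0 < lam / (lam - \<theta> * h_fun w x)" using le[OF that] lam by simp
      then show ?thesis using False by (simp add: g_def ereal_log_def)
    qed
    have [measurable]: "g \<in> borel_measurable unit_lborel"
      unfolding g_def by measurable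
    have "ereal (\<theta> * y) - unit_integral g
        \<le> unit_integral (\<lambda>x. ereal (exp_rel_entropy (y * lam / h_fun w x)))"
    proof (rule const_minus_unit_integral_le)
      show "(\<lambda>x. ereal (exp_rel_entropy (y * lam / h_fun w x))) \<in> borel_measurable unit_lborel"
        unfolding exp_rel_entropy_def by measurable
      show "AE x in unit_lborel. 0 \<le> ereal (exp_rel_entropy (y * lam / h_fun w x))"
        using AE_exp_rel_entropy_nonneg[OF y] by simp
      show "AE x in unit_lborel. ereal (\<theta> * y) - g x \<le> ereal (exp_rel_entropy (y * lam / h_fun w x))"
        using AE_h_fun_pos AE_space
      proof eventually_elim
        case (elim x)
        then have x: "x \<in> {0..<1}" by (simp add: space_restrict_space)
        define u where "u = lam - \<theta> * h_fun w x"
        show ?case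
        proof (cases "\<theta> * h_fun w x = lam")
          case False
          then have u: "0 < u" using le[OF x] by (simp add: u_def)
          have "0 \<le> exp_rel_entropy (y * u / h_fun w x)"
            using u y elim by (intro exp_rel_entropy_nonneg) simp
          moreover have "y * u / h_fun w x = y * lam / h_fun w x - \<theta> * y"
            using elim by (simp add: u_def field_simps)
          moreover have "ln (y * u / h_fun w x) = ln (y * lam / h_fun w x) - ln (lam / u)"
            using u y elim lam by (simp add: ln_mult ln_div)
          ultimately have "\<theta> * y - ln (lam / u) \<le> exp_rel_entropy (y * lam / h_fun w x)"
            by (simp add: exp_rel_entropy_def)
          then show ?thesis using False by (simp add: g[OF x] u_def)
        qed (simp add: g[OF x])
      qed
      \<comment> \<open>From \<open>ln s \<le> s - 1\<close> at \<open>s = u / lam\<close>, the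
        negative part of \<open>g\<close> is at most \<open>u / lam\<close>, and boundedness of
        \<open>h\<close> gives \<open>u \<le> lam + \<bar>\<theta>\<bar> * B\<close>.\<close>
      have "(\<integral>\<^sup>+ x. e2ennreal (- g x) \<partial>unit_lborel)
          \<le> (\<integral>\<^sup>+ x. ennreal ((lam + \<bar>\<theta>\<bar> * B) / lam) \<partial>unit_lborel)"
      proof (rule nn_integral_mono)
        fix x assume "x \<in> space unit_lborel"
        then have x: "x \<in> {0..<1}" by (simp add: space_restrict_space)
        define u where "u = lam - \<theta> * h_fun w x"
        show "e2ennreal (- g x) \<le> ennreal ((lam + \<bar>\<theta>\<bar> * B) / lam)"
        proof (cases "\<theta> * h_fun w x = lam")
          case False
          then have u: "0 < u" using le[OF x] by (simp add: u_def)
          have "- (\<theta> * h_fun w x) \<le> \<bar>\<theta>\<bar> * B"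
            using abs_ge_minus_self[of "\<theta> * h_fun w x"] mult_left_mono[OF B(2)[OF x], of "\<bar>\<theta>\<bar>"]
            by (simp add: abs_mult)
          then have "u / lam \<le> (lam + \<bar>\<theta>\<bar> * B) / lam"
            using lam by (simp add: u_def divide_right_mono)
          moreover have "- ln (lam / u) \<le> u / lam"
            using u lam ln_le_minus_one[of "u / lam"] by (simp add: ln_div)
          ultimately show ?thesis
            using False by (auto simp: g[OF x] e2ennreal_ereal u_def intro!: ennreal_leI)
        qed (simp add: g[OF x] e2ennreal_neg)
      qed
      then show "(\<integral>\<^sup>+ x. e2ennreal (- g x) \<partial>unit_lborel) < \<infinity>"
        by (rule order_le_less_trans) simp
    qed measurable
    then show ?thesis
      unfolding Lambda_def if_P[OF True] M_fun_eq[OF y] g_def[abs_def] .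
  qed (simp add: Lambda_def)
qed

text \<open>Along \<open>\<theta> = - n\<close> the term \<open>\<theta> * y\<close> is nonnegative, while \<open>- Lambda\<close> is the integral of
  \<open>ln (1 + n * h / lam)\<close>, which increases to \<open>\<infinity>\<close> by monotone convergence.\<close>

lemma Lambda_star_eq_infinity:
  assumes y: "y \<le> 0"
  shows "Lambda_star lam w y = \<infinity>"
proof -
  \<comment> \<open>The absolute value makes \<open>f\<close> monotone in \<open>n\<close> at every
    real \<open>x\<close>, also outside \<open>{0..<1}\<close>, where the sign of \<open>h\<close>
    is unknown.\<close>
  define f where "f n x = ennreal (ln (1 + real n * \<bar>h_fun w x\<bar> / lam))" for n x
  have [measurable]: "f n \<in> borel_measurable unit_lborel" for n
    unfolding f_def by measurable
  have Lam: "Lambda lam w (- real n) = - enn2ereal (\<integral>\<^sup>+ x. f n x \<partial>unit_lborel)" for n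
  proof -
    \<comment> \<open>The constraint is a supremum over all points, so a.e. positivity is not enough
      here; \<open>h_fun_nonneg\<close> supplies the sign everywhere.\<close>
    have le: "(SUP x\<in>{0..<1}. ereal (- real n * h_fun w x)) \<le> ereal lam"
    proof (rule SUP_least)
      fix x :: real assume "x \<in> {0..<1}"
      then have "0 \<le> real n * h_fun w x" using h_fun_nonneg by simp
      then show "ereal (- real n * h_fun w x) \<le> ereal lam" using lam by simp
    qed
    have "Lambda lam w (- real n) = unit_integral (\<lambda>x. ereal (- ln (1 + real n * \<bar>h_fun w x\<bar> / lam)))"
      unfolding Lambda_def if_P[OF le]
    proof (rule unit_integral_cong_AE, rule AE_I2)
      fix x assume "x \<in> space unit_lborel"
      then have h: "0 \<le> h_fun w x" using h_fun_nonneg by (simp add: space_restrict_space)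
      then have u: "0 < lam + real n * h_fun w x" using lam by (simp add: add_pos_nonneg)
      have "ln (lam / (lam + real n * h_fun w x)) = - ln (1 + real n * \<bar>h_fun w x\<bar> / lam)"
      proof -
        have "1 + real n * \<bar>h_fun w x\<bar> / lam = (lam + real n * h_fun w x) / lam"
          using h lam by (simp add: add_divide_distrib)
        then show ?thesis using u lam by (simp add: ln_div)
      qed
      then show "ereal_log (ereal lam / ereal (lam - - real n * h_fun w x)) =
          ereal (- ln (1 + real n * \<bar>h_fun w x\<bar> / lam))"
        using u lam by (auto simp: ereal_log_def divide_le_0_iff)
    qed
    also have "\<dots> = - enn2ereal (\<integral>\<^sup>+ x. e2ennreal (- ereal (- ln (1 + real n * \<bar>h_fun w x\<bar> / lam))) \<partial>unit_lborel)"
      using lam by (intro unit_integral_nonpos AE_I2) auto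
    finally show ?thesis by (simp add: f_def e2ennreal_ereal)
  qed
  have "(SUP n. \<integral>\<^sup>+ x. f n x \<partial>unit_lborel) = (\<integral>\<^sup>+ x. (SUP n. f n x) \<partial>unit_lborel)"
  proof (rule nn_integral_monotone_convergence_SUP[symmetric])
    show "incseq f"
      using lam unfolding f_def
      by (intro incseq_SucI le_funI ennreal_leI)
         (simp add: add_pos_nonneg divide_right_mono mult_right_mono)
  qed measurable
  also have "\<dots> = (\<integral>\<^sup>+ x. \<infinity> \<partial>unit_lborel)"
  proof (rule nn_integral_cong_AE)
    show "AE x in unit_lborel. (SUP n. f n x) = \<infinity>"
      using AE_h_fun_pos
    proof eventually_elim
      case (elim x)
      have "filterlim (\<lambda>n. 1 + real n * (\<bar>h_fun w x\<bar> / lam)) at_top sequentially"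
        using elim lam
        by (intro filterlim_tendsto_add_at_top[OF tendsto_const]
             filterlim_at_top_mult_tendsto_pos[OF tendsto_const _ filterlim_real_sequentially]) auto
      then have "filterlim (\<lambda>n. ln (1 + real n * \<bar>h_fun w x\<bar> / lam)) at_top sequentially"
        by (auto intro!: filterlim_compose[OF ln_at_top])
      then have *: "\<exists>n. K \<le> ln (1 + real n * \<bar>h_fun w x\<bar> / lam)" for K
        by (force simp: filterlim_at_top eventually_sequentially)
      show ?case
        unfolding infinity_ennreal_def
      proof (rule ennreal_SUP_eq_top)
        fix k :: nat
        show "\<exists>i\<in>UNIV. of_nat k \<le> f i x"
          using *[of "real k"] by (auto simp: f_def ennreal_of_nat_eq_real_of_nat intro!: ennreal_leI)
      qed
    qed
  qed
  finally have sup: "(SUP n. \<integral>\<^sup>+ x. f n x \<partial>unit_lborel) = \<infinity>"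
    by (simp add: ennreal_mult_eq_top_iff)
  have ge: "enn2ereal (\<integral>\<^sup>+ x. f n x \<partial>unit_lborel) \<le> Lambda_star lam w y" for n
  proof -
    have "enn2ereal (\<integral>\<^sup>+ x. f n x \<partial>unit_lborel) \<le> ereal (- real n * y) - Lambda lam w (- real n)"
      using y unfolding Lam
      by (simp add: add_increasing mult_nonneg_nonpos zero_ereal_def[symmetric])
    also have "\<dots> \<le> Lambda_star lam w y"
      unfolding Lambda_star_def by (rule SUP_upper) simp
    finally show ?thesis .
  qed
  \<comment> \<open>The comparison is made in \<open>ennreal\<close>, where \<open>sup\<close>
    lives. Nothing is lost, since \<open>e2ennreal\<close> is infinite only at plus
    infinity.\<close>
  have "(SUP n. \<integral>\<^sup>+ x. f n x \<partial>unit_lborel) \<le> e2ennreal (Lambda_star lam w y)"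
    using e2ennreal_mono[OF ge] by (intro SUP_least) simp
  then have "e2ennreal (Lambda_star lam w y) = \<infinity>" using sup by (simp add: top_unique)
  then show ?thesis by (cases "Lambda_star lam w y") (auto simp: e2ennreal_ereal e2ennreal_neg)
qed

section \<open>Divergence and minimum of \<open>M_fun\<close>\<close>

lemma h_inv_integral_eq:
  "h_inv_integral w = enn2ereal (\<integral>\<^sup>+ x. ennreal (1 / h_fun w x) \<partial>unit_lborel)"
proof -
  have "AE x in unit_lborel. 0 \<le> ereal (1 / h_fun w x)"
    using AE_h_fun_pos by eventually_elim simp
  then show ?thesis
    unfolding h_inv_integral_def by (simp add: unit_integral_nonneg e2ennreal_ereal)
qed

text \<open>By contraposition: \<open>exp_rel_entropy_ge\<close> bounds \<open>1 / h\<close> by a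
  multiple of the entropy integrand plus a constant, so a finite \<open>M_fun\<close> would make
  \<open>1 / h\<close> integrable. The factor \<open>2 / (y * lam)\<close> turns
  \<open>t / 2\<close> back into \<open>1 / h\<close>.\<close>

lemma M_fun_eq_infinity:
  assumes inf: "h_inv_integral w = \<infinity>" and y: "0 < y"
  shows "M_fun lam w y = \<infinity>"
proof (rule ccontr)
  assume fin: "M_fun lam w y \<noteq> \<infinity>"
  define K where "K = (\<integral>\<^sup>+ x. ennreal (exp_rel_entropy (y * lam / h_fun w x)) \<partial>unit_lborel)"
  have "M_fun lam w y = enn2ereal K"
    using AE_exp_rel_entropy_nonneg[OF y]
    by (simp add: M_fun_eq[OF y] unit_integral_nonneg e2ennreal_ereal K_def)
  then have K: "K < \<infinity>" using fin by (cases K) (auto simp: top_ennreal.rep_eq)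
  have [measurable]: "(\<lambda>x. exp_rel_entropy (y * lam / h_fun w x)) \<in> borel_measurable unit_lborel"
    unfolding exp_rel_entropy_def by measurable
  have "(\<integral>\<^sup>+ x. ennreal (1 / h_fun w x) \<partial>unit_lborel)
      \<le> (\<integral>\<^sup>+ x. ennreal (2 / (y * lam)) * (ennreal (exp_rel_entropy (y * lam / h_fun w x)) + ennreal (ln 2)) \<partial>unit_lborel)"
  proof (rule nn_integral_mono_AE)
    show "AE x in unit_lborel. ennreal (1 / h_fun w x)
      \<le> ennreal (2 / (y * lam)) * (ennreal (exp_rel_entropy (y * lam / h_fun w x)) + ennreal (ln 2))"
      using AE_h_fun_pos
    proof eventually_elim
      case (elim x)
      have t: "0 < y * lam / h_fun w x" using elim y lam by simp
      have "1 / h_fun w x = 2 / (y * lam) * (y * lam / h_fun w x / 2)"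
        using elim y lam by (simp add: field_simps)
      also have "\<dots> \<le> 2 / (y * lam) * (exp_rel_entropy (y * lam / h_fun w x) + ln 2)"
        using exp_rel_entropy_ge[OF t] y lam by (intro mult_left_mono) auto
      finally show ?case
        using exp_rel_entropy_nonneg[OF t] y lam
        by (simp add: ennreal_leI flip: ennreal_plus ennreal_mult del: times_divide_eq_left)
    qed
  qed
  also have "\<dots> = ennreal (2 / (y * lam)) * (K + ennreal (ln 2))"
    by (simp add: nn_integral_cmult nn_integral_add K_def)
  also have "\<dots> < \<infinity>" using K by (simp add: ennreal_mult_less_top)
  finally show False
    using inf unfolding h_inv_integral_eq by (metis enn2ereal_eq_top_iff infinity_ereal_def less_irrefl infinity_ennreal_def)
qed

text \<open>Linearity separates the dependence on \<open>y\<close> from the constants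
  \<open>I\<close> and \<open>E\<close>, which reduces the minimisation to calculus in one real
  variable. It requires \<open>ln (lam / h)\<close> to be integrable on its own.\<close>

lemma M_fun_finite:
  assumes "h_inv_integral w < \<infinity>"
  obtains I E where "0 < I" "h_inv_integral w = ereal I"
    "\<And>y. 0 < y \<Longrightarrow> M_fun lam w y = ereal (y * lam * I - 1 - ln y - E)"
proof -
  interpret prob_space unit_lborel by (rule prob_space_unit_lborel)
  obtain B where B: "0 < B" "\<And>x. x \<in> {0..<1} \<Longrightarrow> \<bar>h_fun w x\<bar> \<le> B"
    using h_fun_bounded by blast
  have nn: "AE x in unit_lborel. 0 \<le> 1 / h_fun w x"
    using AE_h_fun_pos by eventually_elim simp
  have "(\<integral>\<^sup>+ x. ennreal (1 / h_fun w x) \<partial>unit_lborel) < \<infinity>"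
    using assms unfolding h_inv_integral_eq
    by (cases "\<integral>\<^sup>+ x. ennreal (1 / h_fun w x) \<partial>unit_lborel") (auto simp: top_ennreal.rep_eq)
  then have int: "integrable unit_lborel (\<lambda>x. 1 / h_fun w x)"
    using nn by (intro integrableI_nonneg) auto
  define I where "I = (\<integral>x. 1 / h_fun w x \<partial>unit_lborel)"
  have hI: "h_inv_integral w = ereal I"
    unfolding h_inv_integral_def I_def by (rule unit_integral_integrable[OF int])
  \<comment> \<open>The upper bound on \<open>h\<close> is a lower bound on \<open>1 / h\<close>,
    which keeps \<open>I\<close> away from 0.\<close>
  have "0 < 1 / B" using B by simp
  also have "(\<integral>x. 1 / B \<partial>unit_lborel) \<le> I"
    unfolding I_def
  proof (rule integral_mono_AE)
    show "AE x in unit_lborel. 1 / B \<le> 1 / h_fun w x"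
      using AE_h_fun_pos AE_space
    proof eventually_elim
      case (elim x)
      then show ?case using B(2)[of x] by (intro divide_left_mono) (auto simp: space_restrict_space B)
    qed
  qed (use int in auto)
  then have "1 / B \<le> I" by simp
  finally have I: "0 < I" .
  \<comment> \<open>Applying \<open>ln s \<le> s - 1\<close> to \<open>lam / h\<close> and to its
    reciprocal bounds the logarithm on both sides: above by \<open>lam / h\<close>, which is
    integrable, and below by \<open>- B / lam\<close>, as \<open>h\<close> is bounded.\<close>
  have intlog: "integrable unit_lborel (\<lambda>x. ln (lam / h_fun w x))"
  proof (rule Bochner_Integration.integrable_bound)
    show "integrable unit_lborel (\<lambda>x. lam * (1 / h_fun w x) + B / lam)"
      using int by (intro Bochner_Integration.integrable_add integrable_mult_right) auto
    show "AE x in unit_lborel. norm (ln (lam / h_fun w x)) \<le> norm (lam * (1 / h_fun w x) + B / lam)"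
      using AE_h_fun_pos AE_space
    proof eventually_elim
      case (elim x)
      have "ln (lam / h_fun w x) \<le> lam / h_fun w x - 1"
        using elim lam by (intro ln_le_minus_one) auto
      moreover have "ln (h_fun w x / lam) \<le> h_fun w x / lam - 1"
        using elim lam by (intro ln_le_minus_one) auto
      moreover have "h_fun w x / lam \<le> B / lam" "0 \<le> B / lam" "0 \<le> lam / h_fun w x"
        using elim lam B(2)[of x] B(1) by (auto simp: space_restrict_space divide_right_mono)
      moreover have "ln (h_fun w x / lam) = - ln (lam / h_fun w x)"
        using elim lam by (simp add: ln_div)
      ultimately show ?case unfolding real_norm_def by simp
    qed
  qed measurable
  define E where "E = (\<integral>x. ln (lam / h_fun w x) \<partial>unit_lborel)"
  have "M_fun lam w y = ereal (y * lam * I - 1 - ln y - E)" if y: "0 < y" for y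
  proof -
    have int1: "integrable unit_lborel (\<lambda>x. y * lam * (1 / h_fun w x))"
      by (rule integrable_mult_right) (rule int)
    have int0: "integrable unit_lborel (\<lambda>x. 1 + ln y)" by simp
    have int1_0: "integrable unit_lborel (\<lambda>x. y * lam * (1 / h_fun w x) - (1 + ln y))"
      by (rule Bochner_Integration.integrable_diff[OF int1 int0])
    have "M_fun lam w y = unit_integral (\<lambda>x. ereal (y * lam * (1 / h_fun w x) - (1 + ln y) - ln (lam / h_fun w x)))"
      unfolding M_fun_eq[OF y]
    proof (rule unit_integral_cong_AE)
      show "AE x in unit_lborel. ereal (exp_rel_entropy (y * lam / h_fun w x)) =
          ereal (y * lam * (1 / h_fun w x) - (1 + ln y) - ln (lam / h_fun w x))"
        using AE_h_fun_pos
        by eventually_elim (use y lam in \<open>simp add: exp_rel_entropy_def ln_div ln_mult\<close>)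
    qed
    also have "\<dots> = ereal (\<integral>x. y * lam * (1 / h_fun w x) - (1 + ln y) - ln (lam / h_fun w x) \<partial>unit_lborel)"
      by (intro unit_integral_integrable Bochner_Integration.integrable_diff int1 int0 intlog)
    also have "(\<integral>x. y * lam * (1 / h_fun w x) - (1 + ln y) - ln (lam / h_fun w x) \<partial>unit_lborel)
        = (\<integral>x. y * lam * (1 / h_fun w x) \<partial>unit_lborel) - (\<integral>x. 1 + ln y \<partial>unit_lborel) - E"
      unfolding E_def Bochner_Integration.integral_diff[OF int1_0 intlog]
        Bochner_Integration.integral_diff[OF int1 int0] ..
    also have "\<dots> = y * lam * I - 1 - ln y - E"
      by (simp add: I_def del: times_divide_eq_right)
    finally show ?thesis .
  qed
  with I hI show ?thesis by (rule that)
qed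

lemma M_fun_min_at_y_bar:
  assumes "h_inv_integral w < \<infinity>"
  shows "\<exists>y>0. y_bar lam w = ereal y \<and> M_fun lam w y = (INF z\<in>{0<..}. M_fun lam w z)"
proof -
  obtain I E where I: "0 < I" "h_inv_integral w = ereal I"
    and M: "\<And>y. 0 < y \<Longrightarrow> M_fun lam w y = ereal (y * lam * I - 1 - ln y - E)"
    using M_fun_finite[OF assms] by blast
  define y where "y = 1 / (lam * I)"
  have y: "0 < y" using lam I by (simp add: y_def)
  have "M_fun lam w y \<le> M_fun lam w z" if z: "0 < z" for z
  proof -
    \<comment> \<open>Here \<open>z * (lam * I)\<close> is \<open>z / y\<close>. As
      \<open>y * lam * I = 1\<close>, this inequality is exactly the comparison of the values at
      \<open>y\<close> and \<open>z\<close>.\<close>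
    have "ln (z * (lam * I)) \<le> z * (lam * I) - 1"
      using z lam I by (intro ln_le_minus_one) simp
    moreover have "ln (z * (lam * I)) = ln z - ln y"
      using z lam I by (simp add: y_def ln_mult ln_div)
    moreover have "y * lam * I = 1" using lam I by (simp add: y_def)
    ultimately show ?thesis by (simp add: M y z algebra_simps)
  qed
  then have "M_fun lam w y = (INF z\<in>{0<..}. M_fun lam w z)"
    using y by (intro antisym INF_greatest INF_lower) auto
  moreover have "y_bar lam w = ereal y"
    using lam I by (simp add: y_bar_def y_def inverse_eq_divide)
  ultimately show ?thesis using y by blast
qed

end

text \<open>The minimum claim is split because \<open>y_bar\<close> lies in the domain of
  \<open>M_fun\<close> only if \<open>1 / h\<close> has finite integral. In the divergent case it
  degenerates to the boundary point 0, while \<open>M_fun\<close> is constantly infinite.\<close>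

theorem proposition3p2:
  fixes lam :: real and w :: "real \<Rightarrow> real"
  assumes "0 < lam"
    and "continuous_on {0..1} w"
    and "\<exists>x0 c. x0 \<in> {0<..<1} \<and> 0 < c \<and> (\<forall>x\<in>{1 - x0..1}. \<bar>w x\<bar> \<le> c * (1 - x))"
    and "\<forall>\<^sub>F \<theta> in nhds 0. \<bar>Lambda lam w \<theta>\<bar> \<noteq> \<infinity>"
    and "AE x in lborel. x \<in> {0..<1} \<longrightarrow> 0 < h_fun w x"
  shows "(\<forall>y>0. Lambda_star lam w y \<le> M_fun lam w y) \<and>
    (\<forall>y\<le>0. Lambda_star lam w y = \<infinity>) \<and>
    (h_inv_integral w < \<infinity> \<longrightarrow>
      (\<exists>y>0. y_bar lam w = ereal y \<and> M_fun lam w y = (INF z\<in>{0<..}. M_fun lam w z))) \<and>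
    (h_inv_integral w = \<infinity> \<longrightarrow> y_bar lam w = 0 \<and> (\<forall>z>0. M_fun lam w z = \<infinity>))"
proof -
  note facts = assms(1-3,5)
  have "y_bar lam w = 0" if "h_inv_integral w = \<infinity>"
    using that assms(1) by (simp add: y_bar_def)
  then show ?thesis
    using Lambda_star_le_M_fun[OF facts] Lambda_star_eq_infinity[OF facts]
      M_fun_min_at_y_bar[OF facts] M_fun_eq_infinity[OF facts] by blast
qed

end
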